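(* Let $P$ be a finite poset and let $u\in P^*$. Then the generating functions $F(u)$, $S(u)$, and $A(u)$ are all rational.
   Context: $P^*$ is the free monoid of finite words over $P$. Generalized factor order: $u\le w$ iff there is a factor $w'$ of $w$ (i.e. $w=xw'y$) with $|w'|=|u|$ and $u_i\le w'_i$ for all $i$; such $w'$ is an embedding. $\mathcal{F}(u)=\{w:w\ge u\}$; $\mathcal{S}(u)$ is the set of $w\in\mathcal{F}(u)$ for which every embedding of $u$ into $w$ is a suffix of $w$; $\mathcal{A}(u)=\{w:w\not\ge u\}$. $F(u),S(u),A(u)$ are the sums $\sum w$ over these languages in the algebra $\mathbb{Z}\langle\langle P\rangle\rangle$ of formal power series in noncommuting variables $P$. A series is rational if it can be constructed from elements of $P$ using finitely many algebra operations and star operations $f^*=(\epsilon-f)^{-1}$ (for $f$ without constant term). *)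

theory Defs
  imports Main
begin

text \<open>
  The algebra of integer formal power series in noncommuting variables: a series is given by its
  coefficients on all words. The variables are the elements of a type; for a set \<open>P\<close> of variables
  the algebra over \<open>P\<close> is the subalgebra of the series supported on \<^term>\<open>lists P\<close>.
\<close>

typedef 'a ncps = "UNIV :: ('a list \<Rightarrow> int) set"
  morphisms coeff Abs_ncps
  by simp

lemma coeff_Abs_ncps [simp]: "coeff (Abs_ncps f) = f"
  by (simp add: Abs_ncps_inverse)

lemma ncps_eqI: "(\<And>w. coeff f w = coeff g w) \<Longrightarrow> f = g"
  by (metis coeff_inject ext)

instantiation ncps :: (type) ring_1
begin

definition "0 = Abs_ncps (\<lambda>w. 0)"

definition "1 = Abs_ncps (\<lambda>w. if w = [] then 1 else 0)"

definition "f + g = Abs_ncps (\<lambda>w. coeff f w + coeff g w)"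

definition "- f = Abs_ncps (\<lambda>w. - coeff f w)"

definition "f - g = Abs_ncps (\<lambda>w. coeff f w - coeff g w)"

text \<open>The sum runs over all factorizations of \<open>w\<close> into a prefix and a suffix.\<close>

definition "f * g =
  Abs_ncps (\<lambda>w. \<Sum>k\<le>length w. coeff f (take k w) * coeff g (drop k w))"

lemma coeff_simps [simp]:
  "coeff 0 w = 0"
  "coeff 1 w = (if w = [] then 1 else 0)"
  "coeff (f + g) w = coeff f w + coeff g w"
  "coeff (- f) w = - coeff f w"
  "coeff (f - g) w = coeff f w - coeff g w"
  by (simp_all add: zero_ncps_def one_ncps_def plus_ncps_def uminus_ncps_def minus_ncps_def)

lemma coeff_mult:
  "coeff (f * g) w = (\<Sum>k\<le>length w. coeff f (take k w) * coeff g (drop k w))"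
  by (simp add: times_ncps_def)

lemma ncps_mult_assoc: "f * g * h = f * (g * (h :: 'a ncps))"
proof (rule ncps_eqI)
  fix w :: "'a list"
  let ?n = "length w"
  let ?t = "\<lambda>j k. coeff f (take j w) * coeff g (take (k - j) (drop j w)) * coeff h (drop k w)"
  have "coeff (f * g * h) w = (\<Sum>k\<le>?n. \<Sum>j\<le>k. ?t j k)"
    by (auto simp: coeff_mult sum_distrib_right min_def drop_take intro!: sum.cong)
  also have "\<dots> = (\<Sum>(k, j)\<in>(SIGMA k:{..?n}. {..k}). ?t j k)"
    by (simp add: sum.Sigma)
  also have "\<dots> = (\<Sum>(j, i)\<in>(SIGMA j:{..?n}. {..?n - j}). ?t j (i + j))"
    by (rule sum.reindex_bij_witness[of _ "\<lambda>(j, i). (i + j, j)" "\<lambda>(k, j). (j, k - j)"]) auto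
  also have "\<dots> = (\<Sum>j\<le>?n. \<Sum>i\<le>?n - j. ?t j (i + j))"
    by (simp add: sum.Sigma)
  also have "\<dots> = coeff (f * (g * h)) w"
    by (auto simp: coeff_mult sum_distrib_left mult.assoc intro!: sum.cong)
  finally show "coeff (f * g * h) w = coeff (f * (g * h)) w" .
qed

instance
proof
  fix f g h :: "'a ncps"
  show "f * g * h = f * (g * h)"
    by (rule ncps_mult_assoc)
  show "1 * f = f"
  proof (rule ncps_eqI)
    fix w :: "'a list"
    have "coeff (1 * f) w = (\<Sum>k\<le>length w. if k = 0 then coeff f w else 0)"
      unfolding coeff_mult by (rule sum.cong) auto
    then show "coeff (1 * f) w = coeff f w" by simp
  qed
  show "f * 1 = f"
  proof (rule ncps_eqI)
    fix w :: "'a list"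
    have "coeff (f * 1) w = (\<Sum>k\<le>length w. if k = length w then coeff f w else 0)"
      unfolding coeff_mult by (rule sum.cong) auto
    then show "coeff (f * 1) w = coeff f w" by simp
  qed
  show "(f + g) * h = f * h + g * h"
    by (rule ncps_eqI) (simp add: coeff_mult distrib_right sum.distrib)
  show "f * (g + h) = f * g + f * h"
    by (rule ncps_eqI) (simp add: coeff_mult distrib_left sum.distrib)
  have "coeff (0 :: 'a ncps) [] \<noteq> coeff 1 []"
    by simp
  then show "(0 :: 'a ncps) \<noteq> 1"
    by metis
qed (auto intro!: ncps_eqI)

end

definition letter :: "'a \<Rightarrow> 'a ncps" where
  "letter a = Abs_ncps (\<lambda>w. if w = [a] then 1 else 0)"

text \<open>
  The star \<open>(1 - f)\<inverse>\<close> of a series without constant term. The lemma \<open>star_inverse\<close>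
  below shows that the description operator is well-defined.
\<close>

definition star :: "'a ncps \<Rightarrow> 'a ncps" where
  "star f = (THE g. (1 - f) * g = 1 \<and> g * (1 - f) = 1)"

lemma coeff_power_eq_0:
  assumes "coeff f [] = 0"
  shows "length w < k \<Longrightarrow> coeff (f ^ k) w = 0"
proof (induction k arbitrary: w)
  case (Suc k)
  have "coeff f (take j w) * coeff (f ^ k) (drop j w) = 0" if "j \<le> length w" for j
    using assms Suc that by (cases "j = 0") auto
  then show ?case
    by (auto simp: coeff_mult intro!: sum.neutral)
qed simp

lemma star_inverse:
  assumes f: "coeff f [] = 0"
  shows "(1 - f) * star f = 1" and "star f * (1 - f) = 1"
proof -
  define G where "G n = (\<Sum>k<n. f ^ k)" for n
  have left: "(1 - f) * G n = 1 - f ^ n" for n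
  proof (induction n)
    case (Suc n)
    have "(1 - f) * G (Suc n) = (1 - f) * G n + (1 - f) * f ^ n"
      by (simp add: G_def distrib_left)
    then show ?case
      unfolding Suc by (simp add: left_diff_distrib)
  qed (simp add: G_def)
  have right: "G n * (1 - f) = 1 - f ^ n" for n
  proof (induction n)
    case (Suc n)
    have "G (Suc n) * (1 - f) = G n * (1 - f) + f ^ n * (1 - f)"
      by (simp add: G_def distrib_right)
    then show ?case
      unfolding Suc by (simp add: right_diff_distrib power_commutes)
  qed (simp add: G_def)
  define g where "g = Abs_ncps (\<lambda>w. coeff (G (Suc (length w))) w)"
  have G_Suc: "coeff (G (Suc n)) w = coeff (G n) w + coeff (f ^ n) w" for n w
    by (simp add: G_def)
  have stable: "coeff (G n) w = coeff (G (Suc (length w))) w" if "Suc (length w) \<le> n" for n w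
    using that
  proof (induction n rule: dec_induct)
    case (step n)
    then show ?case
      using coeff_power_eq_0[OF f, of w n] by (simp add: G_Suc)
  qed simp
  have g: "coeff g v = coeff (G (Suc n)) v" if "length v \<le> n" for v n
    using stable[of v "Suc n"] that by (simp add: g_def)
  have *: "(1 - f) * g = 1"
  proof (rule ncps_eqI)
    fix w :: "'a list"
    have "coeff ((1 - f) * g) w = coeff ((1 - f) * G (Suc (length w))) w"
      unfolding coeff_mult by (intro sum.cong refl arg_cong2[where f = "(*)"] g) auto
    then show "coeff ((1 - f) * g) w = coeff 1 w"
      by (simp add: left coeff_power_eq_0[OF f] del: power_Suc)
  qed
  have **: "g * (1 - f) = 1"
  proof (rule ncps_eqI)
    fix w :: "'a list"
    have "coeff (g * (1 - f)) w = coeff (G (Suc (length w)) * (1 - f)) w"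
      unfolding coeff_mult by (intro sum.cong refl arg_cong2[where f = "(*)"] g) auto
    then show "coeff (g * (1 - f)) w = coeff 1 w"
      by (simp add: right coeff_power_eq_0[OF f] del: power_Suc)
  qed
  have "star f = g"
    unfolding star_def
  proof (rule the_equality)
    fix h assume "(1 - f) * h = 1 \<and> h * (1 - f) = 1"
    then show "h = g"
      by (metis * mult.assoc mult_1_left mult_1_right)
  qed (use * ** in simp)
  with * ** show "(1 - f) * star f = 1" "star f * (1 - f) = 1"
    by simp_all
qed

text \<open>
  The algebra operations are those of a unital \<open>\<int>\<close>-algebra; the nullary operation \<open>1\<close> is listed
  explicitly, as it cannot be obtained from letters when \<open>P\<close> is empty.
\<close>

inductive rational :: "'a set \<Rightarrow> 'a ncps \<Rightarrow> bool" for P where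
  letter: "a \<in> P \<Longrightarrow> rational P (letter a)"
| one: "rational P 1"
| add: "rational P f \<Longrightarrow> rational P g \<Longrightarrow> rational P (f + g)"
| scale: "rational P f \<Longrightarrow> rational P (of_int c * f)"
| mult: "rational P f \<Longrightarrow> rational P g \<Longrightarrow> rational P (f * g)"
| star: "rational P f \<Longrightarrow> coeff f [] = 0 \<Longrightarrow> rational P (star f)"

text \<open>
  In what follows \<open>r\<close> is the order relation on \<open>P\<close>. An embedding of \<open>u\<close> into \<open>w\<close> is an
  occurrence of a factor, \<^term>\<open>w = x @ v @ y\<close>; it is a suffix of \<open>w\<close> iff \<^term>\<open>y = []\<close>. Thus
  different occurrences of the same word \<open>v\<close> in \<open>w\<close> are different embeddings.
\<close>

definition embedding :: "'a rel \<Rightarrow> 'a list \<Rightarrow> 'a list \<Rightarrow> 'a list \<Rightarrow> 'a list \<Rightarrow> 'a list \<Rightarrow> bool" where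
  "embedding r u w x v y \<longleftrightarrow> w = x @ v @ y \<and> list_all2 (\<lambda>a b. (a, b) \<in> r) u v"

definition factor_le :: "'a rel \<Rightarrow> 'a list \<Rightarrow> 'a list \<Rightarrow> bool" where
  "factor_le r u w \<longleftrightarrow> (\<exists>x v y. embedding r u w x v y)"

definition F_lang :: "'a set \<Rightarrow> 'a rel \<Rightarrow> 'a list \<Rightarrow> 'a list set" where
  "F_lang P r u = {w \<in> lists P. factor_le r u w}"

definition S_lang :: "'a set \<Rightarrow> 'a rel \<Rightarrow> 'a list \<Rightarrow> 'a list set" where
  "S_lang P r u = {w \<in> F_lang P r u. \<forall>x v y. embedding r u w x v y \<longrightarrow> y = []}"

definition A_lang :: "'a set \<Rightarrow> 'a rel \<Rightarrow> 'a list \<Rightarrow> 'a list set" where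
  "A_lang P r u = {w \<in> lists P. \<not> factor_le r u w}"

definition gen_fun :: "'a list set \<Rightarrow> 'a ncps" where
  "gen_fun L = Abs_ncps (\<lambda>w. if w \<in> L then 1 else 0)"

end

theory Submission
  imports Defs
begin

text \<open>
  The language \<open>A(u)\<close> has finitely many left quotients: if \<open>v\<close> avoids \<open>u\<close>, whether \<open>v @ w\<close> avoids \<open>u\<close>
  depends only on \<open>w\<close> and the last \<open>|u|\<close> letters of \<open>v\<close>. The generating functions of the quotients
  solve a finite linear system with proper rational coefficients, and eliminating one unknown at a
  time with \<open>X = c + m X \<Longrightarrow> X = m\<^sup>* c\<close> shows that they are rational. Finally
  \<open>F(u) = P\<^sup>* - A(u)\<close>, and since a nonempty word has no embedding of \<open>u\<close> other than suffixes iff deleting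
  its last letter gives a word of \<open>A(u)\<close>, also \<open>S(u) = 1 + A(u) P - A(u)\<close>.
\<close>

section \<open>Closure properties and coefficient formulas\<close>

lemma rational_zero: "rational P 0"
  using rational.scale[OF rational.one, of P 0] by simp

lemma rational_diff:
  assumes "rational P f" "rational P g"
  shows "rational P (f - g)"
  using rational.add[OF assms(1) rational.scale[OF assms(2), of "-1"]] by simp

lemma rational_sum:
  assumes "\<And>i. i \<in> I \<Longrightarrow> rational P (f i)"
  shows "rational P (sum f I)"
  using assms by (induction I rule: infinite_finite_induct) (auto intro: rational.add rational_zero)

lemma coeff_sum: "coeff (sum f I) w = (\<Sum>i\<in>I. coeff (f i) w)"
  by (induction I rule: infinite_finite_induct) auto

lemma coeff_mult_Nil: "coeff (f * g) [] = coeff f [] * coeff g []"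
  by (simp add: coeff_mult)

lemma coeff_letter: "coeff (letter a) w = (if w = [a] then 1 else 0)"
  by (simp add: letter_def)

lemma coeff_gen_fun: "coeff (gen_fun L) w = (if w \<in> L then 1 else 0)"
  by (simp add: gen_fun_def)

lemma coeff_letter_mult:
  "coeff (letter a * f) w = (if w \<noteq> [] \<and> hd w = a then coeff f (tl w) else 0)"
proof (cases w)
  case (Cons b v)
  \<comment> \<open>The left factor must be the one-letter word \<open>[a]\<close>, so only the cut
    after the first letter contributes.\<close>
  have "coeff (letter a * f) w = (\<Sum>k\<le>length w. if k = 1 then (if b = a then coeff f v else 0) else 0)"
    unfolding coeff_mult
  proof (rule sum.cong)
    fix k assume "k \<in> {..length w}"
    then show "coeff (letter a) (take k w) * coeff f (drop k w)
      = (if k = 1 then if b = a then coeff f v else 0 else 0)"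
      using Cons by (cases k) (auto simp: coeff_letter)
  qed simp
  also have "\<dots> = (if b = a then coeff f v else 0)"
    using Cons by (subst sum.delta) auto
  finally show ?thesis using Cons by simp
qed (simp add: coeff_mult_Nil coeff_letter)

lemma coeff_mult_letter:
  "coeff (f * letter a) w = (if w \<noteq> [] \<and> last w = a then coeff f (butlast w) else 0)"
proof (cases w rule: rev_cases)
  case (snoc v b)
  have "coeff (f * letter a) w
    = (\<Sum>k\<le>length w. if k = length v then (if b = a then coeff f v else 0) else 0)"
    unfolding coeff_mult
  proof (rule sum.cong)
    fix k assume "k \<in> {..length w}"
    then have "drop k w \<noteq> [a]" if "k \<noteq> length v"
      using that snoc by (auto dest!: arg_cong[where f = length])
    then show "coeff f (take k w) * coeff (letter a) (drop k w)
      = (if k = length v then if b = a then coeff f v else 0 else 0)"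
      using snoc by (cases "k = length v") (auto simp: coeff_letter)
  qed simp
  then show ?thesis using snoc by simp
qed (simp add: coeff_mult_Nil coeff_letter)

section \<open>Linear systems over rational series\<close>

text \<open>Gaussian elimination: a diagonal coefficient \<open>m\<close> without constant term
  makes \<open>1 - m\<close> invertible, so one equation is solved for its own unknown and
  substituted into the others. The solution \<open>X\<close> stays fixed in the induction, while
  \<open>c\<close> and \<open>M\<close> change.\<close>

lemma linear_system_rational:
  assumes "finite Q"
    and "\<And>q. q \<in> Q \<Longrightarrow> X q = c q + (\<Sum>p\<in>Q. M q p * X p)"
    and "\<And>q. q \<in> Q \<Longrightarrow> rational P (c q)"
    and "\<And>q p. q \<in> Q \<Longrightarrow> p \<in> Q \<Longrightarrow> rational P (M q p)"
    and "\<And>q p. q \<in> Q \<Longrightarrow> p \<in> Q \<Longrightarrow> coeff (M q p) [] = 0"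
    and "q \<in> Q"
  shows "rational P (X q)"
  using assms
proof (induction Q arbitrary: c M q rule: finite_induct)
  case (insert s Q)
  note sys = insert.prems(1) and rat = insert.prems(2,3) and proper = insert.prems(4)
  define t where "t = star (M s s)"
  have rat_t: "rational P t"
    unfolding t_def by (intro rational.star rat(2) proper) auto
  define R where "R = c s + (\<Sum>p\<in>Q. M s p * X p)"
  have "X s = M s s * X s + R"
    using sys[of s] insert.hyps by (simp add: R_def add_ac)
  then have "(1 - M s s) * X s = R"
    by (simp add: left_diff_distrib algebra_simps)
  then have Xs: "X s = t * R"
    using star_inverse(2)[of "M s s"] proper[of s s] unfolding t_def
    by (metis insertI1 mult.assoc mult_1_left)
  \<comment> \<open>Substituting \<open>X s = t * R\<close> into the remaining equations gives the
    new \<open>c\<close> and \<open>M\<close>. The new coefficients have no constant term, because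
    constant terms multiply and neither \<open>M q p\<close> nor \<open>M q s\<close> has
    one.\<close>
  have rat_Q: "rational P (X p)" if "p \<in> Q" for p
  proof (rule insert.IH[where c = "\<lambda>q. c q + M q s * t * c s"
        and M = "\<lambda>q p. M q p + M q s * t * M s p"])
    fix q assume q: "q \<in> Q"
    have "X q = c q + (M q s * X s + (\<Sum>p\<in>Q. M q p * X p))"
      using sys[of q] q insert.hyps by simp
    then show "X q = (c q + M q s * t * c s) + (\<Sum>p\<in>Q. (M q p + M q s * t * M s p) * X p)"
      unfolding Xs R_def
      by (simp add: algebra_simps sum.distrib sum_distrib_left)
  qed (use that rat rat_t proper in
      \<open>auto intro!: rational.add rational.mult simp: coeff_mult_Nil\<close>)
  have "rational P (X s)"
    unfolding Xs R_def using rat rat_t rat_Q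
    by (intro rational.mult rational.add rational_sum) auto
  then show ?case
    using rat_Q insert.prems(5) by auto
qed simp

section \<open>Languages with finitely many left quotients\<close>

lemma gen_fun_quotients:
  assumes "finite P" "L \<subseteq> lists P"
  shows "gen_fun L = (if [] \<in> L then 1 else 0) + (\<Sum>a\<in>P. letter a * gen_fun {w. a # w \<in> L})"
proof (rule ncps_eqI)
  fix w
  show "coeff (gen_fun L) w
    = coeff ((if [] \<in> L then 1 else 0) + (\<Sum>a\<in>P. letter a * gen_fun {w. a # w \<in> L})) w"
    using assms by (cases w) (auto simp: coeff_sum coeff_letter_mult coeff_gen_fun)
qed

text \<open>\<open>Q\<close> serves as the state set of a deterministic finite automaton: reading
  \<open>a\<close> leads from a language to its left quotient by \<open>a\<close>, and the languages
  containing \<open>[]\<close> accept. Each state contributes one linear equation.\<close>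

lemma gen_fun_rational:
  assumes P: "finite P" and Q: "finite Q"
    and words: "\<And>L. L \<in> Q \<Longrightarrow> L \<subseteq> lists P"
    and closed: "\<And>L a. L \<in> Q \<Longrightarrow> a \<in> P \<Longrightarrow> {w. a # w \<in> L} \<in> Q"
    and L: "L \<in> Q"
  shows "rational P (gen_fun L)"
proof (rule linear_system_rational[OF Q])
  fix L assume L: "L \<in> Q"
  \<comment> \<open>Several letters may lead from \<open>L\<close> to the same \<open>K\<close>;
    their sum is the coefficient of \<open>gen_fun K\<close>.\<close>
  let ?A = "\<lambda>K. {a \<in> P. {w. a # w \<in> L} = K}"
  have "(\<Sum>K\<in>Q. (\<Sum>a\<in>?A K. letter a) * gen_fun K)
    = (\<Sum>K\<in>Q. \<Sum>a\<in>?A K. letter a * gen_fun {w. a # w \<in> L})"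
    by (auto simp: sum_distrib_right intro!: sum.cong)
  also have "\<dots> = (\<Sum>a\<in>P. letter a * gen_fun {w. a # w \<in> L})"
    using closed[OF L] by (intro sum.group P Q) auto
  finally show "gen_fun L = (if [] \<in> L then 1 else 0)
      + (\<Sum>K\<in>Q. (\<Sum>a\<in>?A K. letter a) * gen_fun K)"
    using gen_fun_quotients[OF P words[OF L]] by simp
qed (auto intro!: rational_sum rational.one rational_zero rational.letter L
       simp: coeff_sum coeff_letter)

section \<open>Words avoiding \<open>u\<close>\<close>

lemma factor_le_appendI1: "factor_le r u v \<Longrightarrow> factor_le r u (v @ w)"
  unfolding factor_le_def embedding_def by (metis append_assoc)

lemma factor_le_appendI2: "factor_le r u w \<Longrightarrow> factor_le r u (v @ w)"
  unfolding factor_le_def embedding_def by (metis append_assoc)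

text \<open>No embedding ends inside \<open>v\<close>, so every embedding into \<open>v @ w\<close>
  ends in \<open>w\<close> and reaches back over fewer than \<open>length u\<close> letters of
  \<open>v\<close>. If \<open>v\<close> is shorter than \<open>u\<close>, the truncated subtraction
  drops nothing.\<close>

lemma factor_le_append_drop:
  assumes v: "\<not> factor_le r u v"
  shows "factor_le r u (v @ w) \<longleftrightarrow> factor_le r u (drop (length v - length u) v @ w)"
proof
  assume "factor_le r u (v @ w)"
  then obtain x z y where eq: "v @ w = x @ z @ y" and z: "list_all2 (\<lambda>a b. (a, b) \<in> r) u z"
    unfolding factor_le_def embedding_def by blast
  have "\<not> length (x @ z) \<le> length v"
  proof
    assume "length (x @ z) \<le> length v"
    then obtain y' where "v = (x @ z) @ y'"
      using eq by (metis append_assoc append_eq_append_conv_if append_take_drop_id)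
    with z v show False
      unfolding factor_le_def embedding_def by (metis append_assoc)
  qed
  then have len: "length v - length u \<le> length x"
    using list_all2_lengthD[OF z] by simp
  \<comment> \<open>The deleted prefix is no longer than \<open>x\<close>, so the occurrence
    \<open>z\<close> survives intact.\<close>
  have "drop (length v - length u) (v @ w) = drop (length v - length u) x @ z @ y"
    unfolding eq using len by simp
  then show "factor_le r u (drop (length v - length u) v @ w)"
    using z unfolding factor_le_def embedding_def by auto
next
  assume "factor_le r u (drop (length v - length u) v @ w)"
  from factor_le_appendI2[OF this, of "take (length v - length u) v"]
  show "factor_le r u (v @ w)"
    by (metis append_assoc append_take_drop_id)
qed

lemma finite_quotients_A_lang:
  assumes "finite P"
  shows "finite ((\<lambda>v. {w. v @ w \<in> A_lang P r u}) ` lists P)" (is "finite (?q ` _)")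
proof (rule finite_subset)
  \<comment> \<open>All words that contain \<open>u\<close> share the quotient \<open>{}\<close>,
    the sink state.\<close>
  show "?q ` lists P \<subseteq> insert {} (?q ` {v. set v \<subseteq> P \<and> length v \<le> length u})"
  proof (rule image_subsetI)
    fix v assume v: "v \<in> lists P"
    show "?q v \<in> insert {} (?q ` {v. set v \<subseteq> P \<and> length v \<le> length u})"
    proof (cases "factor_le r u v")
      case True
      then show ?thesis
        by (auto simp: A_lang_def factor_le_appendI1)
    next
      case False
      let ?v = "drop (length v - length u) v"
      have "?v \<in> {v. set v \<subseteq> P \<and> length v \<le> length u}"
        using v set_drop_subset[of "length v - length u" v] by auto
      moreover from this have "?q v = ?q ?v"
        using v factor_le_append_drop[OF False] by (auto simp: A_lang_def)
      ultimately show ?thesis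
        by blast
    qed
  qed
  show "finite (insert {} (?q ` {v. set v \<subseteq> P \<and> length v \<le> length u}))"
    using finite_lists_length_le[OF assms] by simp
qed

lemma rational_A_lang:
  assumes "finite P"
  shows "rational P (gen_fun (A_lang P r u))"
proof (rule gen_fun_rational[OF assms finite_quotients_A_lang[OF assms]])
  show "A_lang P r u \<in> (\<lambda>v. {w. v @ w \<in> A_lang P r u}) ` lists P"
    by (rule image_eqI[where x = "[]"]) auto
next
  fix L a
  assume "L \<in> (\<lambda>v. {w. v @ w \<in> A_lang P r u}) ` lists P" and a: "a \<in> P"
  then obtain v where "v \<in> lists P" "L = {w. v @ w \<in> A_lang P r u}"
    by blast
  \<comment> \<open>Quotients compose: the quotient by \<open>v\<close> followed by the one by
    \<open>a\<close> is the quotient by \<open>v @ [a]\<close>.\<close>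
  then show "{w. a # w \<in> L} \<in> (\<lambda>v. {w. v @ w \<in> A_lang P r u}) ` lists P"
    using a by (intro image_eqI[where x = "v @ [a]"]) auto
qed (auto simp: A_lang_def)

section \<open>Words in which every embedding is a suffix\<close>

text \<open>Embeddings into \<open>w\<close> correspond to those embeddings into
  \<open>w @ [a]\<close> that miss the last letter, that is, to the non-suffix ones.\<close>

lemma S_lang_snoc:
  "w @ [a] \<in> S_lang P r u \<longleftrightarrow> w @ [a] \<in> F_lang P r u \<and> w \<in> A_lang P r u"
proof -
  have "(\<forall>x v y. embedding r u (w @ [a]) x v y \<longrightarrow> y = []) \<longleftrightarrow> \<not> factor_le r u w"
  proof
    assume suffix: "\<forall>x v y. embedding r u (w @ [a]) x v y \<longrightarrow> y = []"
    show "\<not> factor_le r u w"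
    proof
      assume "factor_le r u w"
      then obtain x v y where "embedding r u w x v y"
        unfolding factor_le_def by blast
      then have "embedding r u (w @ [a]) x v (y @ [a])"
        by (simp add: embedding_def)
      with suffix show False
        by blast
    qed
  next
    assume avoid: "\<not> factor_le r u w"
    show "\<forall>x v y. embedding r u (w @ [a]) x v y \<longrightarrow> y = []"
    proof (intro allI impI)
      fix x v y assume emb: "embedding r u (w @ [a]) x v y"
      show "y = []"
      proof (cases y rule: rev_cases)
        case (snoc y' b)
        then have "embedding r u w x v y'"
          using emb by (simp add: embedding_def flip: append_assoc)
        with avoid show ?thesis
          unfolding factor_le_def by blast
      qed
    qed
  qed
  then show ?thesis
    by (auto simp: S_lang_def F_lang_def A_lang_def)
qed

lemma gen_fun_F_lang: "gen_fun (F_lang P r u) = gen_fun (lists P) - gen_fun (A_lang P r u)"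
  by (rule ncps_eqI) (simp add: coeff_gen_fun F_lang_def A_lang_def)

text \<open>Appending a letter of \<open>P\<close> to a word of \<open>A(u)\<close> gives either a
  word of \<open>S(u)\<close> or a nonempty word of \<open>A(u)\<close>, and all such words arise
  once. The summand \<open>1\<close> accounts for the empty word, which lies in exactly one of
  \<open>S(u)\<close> and \<open>A(u)\<close>.\<close>

lemma gen_fun_S_lang:
  assumes "finite P"
  shows "gen_fun (S_lang P r u)
    = 1 + gen_fun (A_lang P r u) * (\<Sum>a\<in>P. letter a) - gen_fun (A_lang P r u)"
proof (rule ncps_eqI)
  fix w
  show "coeff (gen_fun (S_lang P r u)) w
    = coeff (1 + gen_fun (A_lang P r u) * (\<Sum>a\<in>P. letter a) - gen_fun (A_lang P r u)) w"
  proof (cases w rule: rev_cases)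
    case Nil
    have "[] \<in> S_lang P r u \<longleftrightarrow> [] \<notin> A_lang P r u"
      by (auto simp: S_lang_def F_lang_def A_lang_def embedding_def)
    then show ?thesis
      using Nil by (simp add: coeff_gen_fun coeff_mult_Nil coeff_sum coeff_letter)
  next
    case (snoc v a)
    \<comment> \<open>Avoidance passes to prefixes, so the subtracted nonempty words all occur in
      the product.\<close>
    have "v \<in> A_lang P r u" if "v @ [a] \<in> A_lang P r u"
      using that factor_le_appendI1[of r u v "[a]"] by (auto simp: A_lang_def)
    then show ?thesis
      using snoc assms
      by (auto simp: sum_distrib_left coeff_sum coeff_mult_letter coeff_gen_fun S_lang_snoc)
         (auto simp: F_lang_def A_lang_def)
  qed
qed

theorem theorem2p3:
  fixes P :: "'a set" and r :: "'a rel" and u :: "'a list"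
  assumes "finite P" and "partial_order_on P r" and "u \<in> lists P"
  shows "rational P (gen_fun (F_lang P r u))
    \<and> rational P (gen_fun (S_lang P r u))
    \<and> rational P (gen_fun (A_lang P r u))"
proof -
  have A: "rational P (gen_fun (A_lang P r u))"
    using assms(1) by (rule rational_A_lang)
  have "rational P (gen_fun (lists P))"
    \<comment> \<open>\<open>lists P\<close> is its own quotient by every letter of
      \<open>P\<close>: an automaton with one state.\<close>
    by (rule gen_fun_rational[OF assms(1), where Q = "{lists P}"]) auto
  then have "rational P (gen_fun (F_lang P r u))"
    unfolding gen_fun_F_lang using A by (rule rational_diff)
  moreover have "rational P (gen_fun (S_lang P r u))"
    unfolding gen_fun_S_lang[OF assms(1)] using A
    by (intro rational_diff rational.add rational.mult rational_sum rational.one rational.letter)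
  ultimately show ?thesis
    using A by blast
qed

end
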